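(* Let $\Gamma$ be a simplicial graph with vertex set $V(\Gamma)$, and let $A_\Gamma$ be the right-angled Artin group defined by $\Gamma$. Suppose there are adjacent vertices $a,b \in V(\Gamma)$ with $a \le b$ (that is, $\operatorname{lk}(a) \subset \operatorname{st}(b)$), such that $b$ is not adjacent to all the other vertices of $\Gamma$. Then no finite-index subgroup of $\operatorname{Aut}(A_\Gamma)$ can act properly by semi-simple isometries on a (non-empty) $\mathrm{CAT}(0)$ space.
   Context: A simplicial graph is a graph without loops or multiple edges; $V(\Gamma)$ and $E(\Gamma)$ denote its sets of vertices and edges. The right-angled Artin group $A_\Gamma$ is the group generated by $V(\Gamma)$ with defining relations $[v,w]=1$ exactly for those pairs $v,w$ with $vw \in E(\Gamma)$. For a vertex $v$, the link $\operatorname{lk}(v)$ is the set of vertices adjacent to $v$, and the star is $\operatorname{st}(v)=\operatorname{lk}(v)\cup\{v\}$. For $v,w\in V(\Gamma)$, one writes $v \le w$ if $\operatorname{lk}(v)\subset \operatorname{st}(w)$. Terminology on actions follows Bridson–Haefliger: an action of a group $G$ by isometries on a metric space $X$ is proper if every $x\in X$ has some $r>0$ such that $\{g\in G : g\cdot B(x,r)\cap B(x,r)\neq\emptyset\}$ is finite; an isometry $g$ of $X$ is semi-simple if the displacement function $x\mapsto d(x,gx)$ attains its infimum on $X$; $G$ acts by semi-simple isometries if every element of $G$ acts as a semi-simple isometry. *)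

theory Defs
  imports "HOL-Analysis.Analysis" "HOL-Algebra.Group_Action"
begin

section \<open>Groups given by generators and relators\<close>

text \<open>The letter \<open>(s, True)\<close> stands for the generator \<open>s\<close>, and \<open>(s, False)\<close> for its formal inverse.\<close>

type_synonym 'a word = "('a \<times> bool) list"

definition words :: "'a set \<Rightarrow> 'a word set" where
  "words S = lists (S \<times> UNIV)"

inductive word_step :: "'a set \<Rightarrow> 'a word set \<Rightarrow> 'a word \<Rightarrow> 'a word \<Rightarrow> bool"
  for S :: "'a set" and R :: "'a word set" where
  cancel: "x \<in> words S \<Longrightarrow> y \<in> words S \<Longrightarrow> s \<in> S \<Longrightarrow>
    word_step S R (x @ [(s, e), (s, \<not> e)] @ y) (x @ y)"
| relator: "x \<in> words S \<Longrightarrow> y \<in> words S \<Longrightarrow> r \<in> R \<Longrightarrow> r \<in> words S \<Longrightarrow>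
    word_step S R (x @ r @ y) (x @ y)"

definition word_rel :: "'a set \<Rightarrow> 'a word set \<Rightarrow> ('a word \<times> 'a word) set" where
  "word_rel S R = {(u, v). u \<in> words S \<and> v \<in> words S \<and> equivclp (word_step S R) u v}"

definition presented_group :: "'a set \<Rightarrow> 'a word set \<Rightarrow> 'a word set monoid" where
  "presented_group S R =
    \<lparr>carrier = words S // word_rel S R,
     mult = (\<lambda>A B. \<Union>u\<in>A. \<Union>v\<in>B. word_rel S R `` {u @ v}),
     one = word_rel S R `` {[]}\<rparr>"

definition inv_word :: "'a word \<Rightarrow> 'a word" where
  "inv_word w = rev (map (\<lambda>(s, e). (s, \<not> e)) w)"

lemma append_in_words [simp]: "u @ v \<in> words S \<longleftrightarrow> u \<in> words S \<and> v \<in> words S"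
  by (auto simp: words_def)

lemma Nil_in_words [simp]: "[] \<in> words S"
  by (simp add: words_def)

lemma Cons_in_words [simp]: "x # v \<in> words S \<longleftrightarrow> fst x \<in> S \<and> v \<in> words S"
  by (cases x) (auto simp: words_def)

lemma inv_word_in_words [simp]: "inv_word w \<in> words S \<longleftrightarrow> w \<in> words S"
  by (induction w) (auto simp: inv_word_def)

lemma equiv_word_rel: "equiv (words S) (word_rel S R)"
  by (rule equivI)
    (auto simp: word_rel_def refl_on_def sym_def trans_def
      intro: equivclp_sym equivclp_trans)

lemma word_step_append:
  assumes "word_step S R u v" "x \<in> words S" "y \<in> words S"
  shows "word_step S R (x @ u @ y) (x @ v @ y)"
  using assms(1)
proof cases
  case (cancel a b s e)
  then show ?thesis
    using word_step.cancel[of "x @ a" S "b @ y" s R e] assms by simp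
next
  case (relator a b r)
  then show ?thesis
    using word_step.relator[of "x @ a" S "b @ y" r R] assms by simp
qed

lemma equivclp_word_step_append:
  assumes "equivclp (word_step S R) u v" "x \<in> words S" "y \<in> words S"
  shows "equivclp (word_step S R) (x @ u @ y) (x @ v @ y)"
  using assms(1)
proof (induction rule: equivclp_induct)
  case (step v w)
  then show ?case
    using word_step_append[OF _ assms(2,3), of R v w] word_step_append[OF _ assms(2,3), of R w v]
    by (meson equivclp_into_equivclp)
qed simp

lemma congruent2_word_rel:
  "congruent2 (word_rel S R) (word_rel S R) (\<lambda>u v. word_rel S R `` {u @ v})"
proof (rule congruent2I')
  fix u u' v v'
  assume *: "(u, u') \<in> word_rel S R" "(v, v') \<in> word_rel S R"
  then have "equivclp (word_step S R) (u @ v) (u' @ v)"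
    using equivclp_word_step_append[of S R u u' "[]" v] by (simp add: word_rel_def)
  moreover have "equivclp (word_step S R) (u' @ v) (u' @ v')"
    using * equivclp_word_step_append[of S R v v' u' "[]"] by (simp add: word_rel_def)
  ultimately have "(u @ v, u' @ v') \<in> word_rel S R"
    using * by (auto simp: word_rel_def intro: equivclp_trans)
  then show "word_rel S R `` {u @ v} = word_rel S R `` {u' @ v'}"
    by (rule equiv_class_eq[OF equiv_word_rel])
qed

lemma mult_presented_group:
  assumes "u \<in> words S" "v \<in> words S"
  shows "word_rel S R `` {u} \<otimes>\<^bsub>presented_group S R\<^esub> word_rel S R `` {v} = word_rel S R `` {u @ v}"
  using UN_equiv_class2[OF equiv_word_rel equiv_word_rel congruent2_word_rel assms]
  by (simp add: presented_group_def)

lemma inv_word_append_cancel: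
  "w \<in> words S \<Longrightarrow> equivclp (word_step S R) (inv_word w @ w) []"
proof (induction w)
  case Nil
  then show ?case by (simp add: inv_word_def)
next
  case (Cons x w)
  have "word_step S R (inv_word w @ [(fst x, \<not> snd x), (fst x, \<not> \<not> snd x)] @ w) (inv_word w @ w)"
    using Cons.prems by (intro word_step.cancel) auto
  then have "word_step S R (inv_word (x # w) @ x # w) (inv_word w @ w)"
    by (simp add: inv_word_def case_prod_unfold)
  with Cons show ?case
    by (auto intro: equivclp_trans r_into_equivclp)
qed

theorem group_presented_group: "group (presented_group S R)"
proof (rule groupI)
  let ?G = "presented_group S R"
  have cls: "\<exists>u\<in>words S. A = word_rel S R `` {u}" if "A \<in> carrier ?G" for A
    using that by (auto simp: presented_group_def elim: quotientE)
  have mem: "word_rel S R `` {u} \<in> carrier ?G" if "u \<in> words S" for u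
    using that by (simp add: presented_group_def quotientI)
  have one: "\<one>\<^bsub>?G\<^esub> = word_rel S R `` {[]}"
    by (simp add: presented_group_def)
  show "A \<otimes>\<^bsub>?G\<^esub> B \<in> carrier ?G" if "A \<in> carrier ?G" "B \<in> carrier ?G" for A B
    using cls[OF that(1)] cls[OF that(2)] by (auto simp: mult_presented_group mem)
  show "\<one>\<^bsub>?G\<^esub> \<in> carrier ?G"
    by (simp add: one mem)
  show "A \<otimes>\<^bsub>?G\<^esub> B \<otimes>\<^bsub>?G\<^esub> C = A \<otimes>\<^bsub>?G\<^esub> (B \<otimes>\<^bsub>?G\<^esub> C)"
    if "A \<in> carrier ?G" "B \<in> carrier ?G" "C \<in> carrier ?G" for A B C
    using cls[OF that(1)] cls[OF that(2)] cls[OF that(3)] by (auto simp: mult_presented_group)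
  show "\<one>\<^bsub>?G\<^esub> \<otimes>\<^bsub>?G\<^esub> A = A" if "A \<in> carrier ?G" for A
    using cls[OF that] by (auto simp: one mult_presented_group)
  show "\<exists>B\<in>carrier ?G. B \<otimes>\<^bsub>?G\<^esub> A = \<one>\<^bsub>?G\<^esub>" if A: "A \<in> carrier ?G" for A
  proof -
    obtain u where u: "u \<in> words S" "A = word_rel S R `` {u}"
      using cls[OF A] by auto
    have "(inv_word u @ u, []) \<in> word_rel S R"
      using u inv_word_append_cancel[of u S R] by (simp add: word_rel_def)
    then have "word_rel S R `` {inv_word u} \<otimes>\<^bsub>?G\<^esub> A = \<one>\<^bsub>?G\<^esub>"
      using u equiv_class_eq[OF equiv_word_rel] by (simp add: one mult_presented_group)
    then show ?thesis
      using u mem[of "inv_word u"] by auto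
  qed
qed


section \<open>Simplicial graphs and right-angled Artin groups\<close>

text \<open>Edges are two-element sets of vertices; the graph may be infinite.\<close>

definition simplicial_graph :: "'v set \<Rightarrow> 'v set set \<Rightarrow> bool" where
  "simplicial_graph V E \<longleftrightarrow> (\<forall>e\<in>E. \<exists>u\<in>V. \<exists>v\<in>V. u \<noteq> v \<and> e = {u, v})"

definition link :: "'v set \<Rightarrow> 'v set set \<Rightarrow> 'v \<Rightarrow> 'v set" where
  "link V E v = {w \<in> V. {v, w} \<in> E}"

definition star :: "'v set \<Rightarrow> 'v set set \<Rightarrow> 'v \<Rightarrow> 'v set" where
  "star V E v = link V E v \<union> {v}"

definition vertex_le :: "'v set \<Rightarrow> 'v set set \<Rightarrow> 'v \<Rightarrow> 'v \<Rightarrow> bool" where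
  "vertex_le V E v w \<longleftrightarrow> link V E v \<subseteq> star V E w"

definition commutator_word :: "'v \<Rightarrow> 'v \<Rightarrow> 'v word" where
  "commutator_word v w = [(v, True), (w, True), (v, False), (w, False)]"

definition raag :: "'v set \<Rightarrow> 'v set set \<Rightarrow> 'v word set monoid" where
  "raag V E = presented_group V {commutator_word v w | v w. v \<in> V \<and> w \<in> V \<and> {v, w} \<in> E}"

lemma group_raag: "group (raag V E)"
  by (simp add: raag_def group_presented_group)


section \<open>\<open>CAT(0)\<close> spaces and isometric actions\<close>

context Metric_space
begin

definition geodesic_path :: "'a \<Rightarrow> 'a \<Rightarrow> real \<Rightarrow> (real \<Rightarrow> 'a) \<Rightarrow> bool" where
  "geodesic_path x y l c \<longleftrightarrow>
    0 \<le> l \<and> c ` {0..l} \<subseteq> M \<and> c 0 = x \<and> c l = y \<and>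
    (\<forall>s\<in>{0..l}. \<forall>t\<in>{0..l}. d (c s) (c t) = \<bar>s - t\<bar>)"

definition geodesic_segment :: "'a \<Rightarrow> 'a \<Rightarrow> 'a set \<Rightarrow> bool" where
  "geodesic_segment x y S \<longleftrightarrow> (\<exists>l c. geodesic_path x y l c \<and> S = c ` {0..l})"

text \<open>Vertices \<open>p, q, r\<close> and a choice of sides \<open>[p, q]\<close>, \<open>[q, r]\<close>, \<open>[r, p]\<close>.\<close>

definition geodesic_triangle ::
    "'a \<Rightarrow> 'a \<Rightarrow> 'a \<Rightarrow> 'a set \<Rightarrow> 'a set \<Rightarrow> 'a set \<Rightarrow> bool" where
  "geodesic_triangle p q r S1 S2 S3 \<longleftrightarrow>
    p \<in> M \<and> q \<in> M \<and> r \<in> M \<and>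
    geodesic_segment p q S1 \<and> geodesic_segment q r S2 \<and> geodesic_segment r p S3"

definition comparison_triangle ::
    "'a \<Rightarrow> 'a \<Rightarrow> 'a \<Rightarrow> real^2 \<Rightarrow> real^2 \<Rightarrow> real^2 \<Rightarrow> bool" where
  "comparison_triangle p q r p' q' r' \<longleftrightarrow>
    dist p' q' = d p q \<and> dist q' r' = d q r \<and> dist r' p' = d r p"

text \<open>\<open>x'\<close> in \<open>[p', q']\<close> is a comparison point for \<open>x\<close> in the side \<open>S\<close> joining \<open>p\<close> to \<open>q\<close>.\<close>

definition side_comparison_point ::
    "'a \<Rightarrow> 'a set \<Rightarrow> real^2 \<Rightarrow> real^2 \<Rightarrow> 'a \<Rightarrow> real^2 \<Rightarrow> bool" where
  "side_comparison_point p S p' q' x x' \<longleftrightarrow>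
    x \<in> S \<and> x' \<in> closed_segment p' q' \<and> dist p' x' = d p x"

definition comparison_point ::
    "'a \<Rightarrow> 'a \<Rightarrow> 'a \<Rightarrow> 'a set \<Rightarrow> 'a set \<Rightarrow> 'a set \<Rightarrow>
     real^2 \<Rightarrow> real^2 \<Rightarrow> real^2 \<Rightarrow> 'a \<Rightarrow> real^2 \<Rightarrow> bool" where
  "comparison_point p q r S1 S2 S3 p' q' r' x x' \<longleftrightarrow>
    side_comparison_point p S1 p' q' x x' \<or>
    side_comparison_point q S2 q' r' x x' \<or>
    side_comparison_point r S3 r' p' x x'"

text \<open>Comparison triangles exist and are unique up to isometries of the plane, so quantifying over
  all of them amounts to choosing one.\<close>

definition CAT0_inequality ::
    "'a \<Rightarrow> 'a \<Rightarrow> 'a \<Rightarrow> 'a set \<Rightarrow> 'a set \<Rightarrow> 'a set \<Rightarrow> bool" where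
  "CAT0_inequality p q r S1 S2 S3 \<longleftrightarrow>
    (\<forall>p' q' r' x y x' y'.
      comparison_triangle p q r p' q' r' \<longrightarrow>
      comparison_point p q r S1 S2 S3 p' q' r' x x' \<longrightarrow>
      comparison_point p q r S1 S2 S3 p' q' r' y y' \<longrightarrow>
      d x y \<le> dist x' y')"

definition isometric_action :: "('g, 'b) monoid_scheme \<Rightarrow> ('g \<Rightarrow> 'a \<Rightarrow> 'a) \<Rightarrow> bool" where
  "isometric_action G \<phi> \<longleftrightarrow>
    group_action G M \<phi> \<and>
    (\<forall>g\<in>carrier G. \<forall>x\<in>M. \<forall>y\<in>M. d (\<phi> g x) (\<phi> g y) = d x y)"

definition proper_action :: "('g, 'b) monoid_scheme \<Rightarrow> ('g \<Rightarrow> 'a \<Rightarrow> 'a) \<Rightarrow> bool" where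
  "proper_action G \<phi> \<longleftrightarrow>
    (\<forall>x\<in>M. \<exists>r>0. finite {g \<in> carrier G. \<phi> g ` mball x r \<inter> mball x r \<noteq> {}})"

definition semi_simple :: "('a \<Rightarrow> 'a) \<Rightarrow> bool" where
  "semi_simple f \<longleftrightarrow> (\<exists>x\<in>M. d x (f x) = (INF y\<in>M. d y (f y)))"

end

text \<open>Completeness is not part of the definition.\<close>

locale CAT0_space = Metric_space M d for M :: "'a set" and d +
  assumes geodesic: "x \<in> M \<Longrightarrow> y \<in> M \<Longrightarrow> \<exists>S. geodesic_segment x y S"
    and CAT0: "geodesic_triangle p q r S1 S2 S3 \<Longrightarrow> CAT0_inequality p q r S1 S2 S3"

end

theory Submission
  imports Defs
begin

text \<open>The transvection \<open>t\<close> with \<open>t a = a b\<close> and the inner automorphisms \<open>\<alpha>\<close>, \<open>\<beta>\<close> of \<open>a\<close>, \<open>b\<close> satisfy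
  \<open>t \<alpha> = \<beta> \<alpha> t\<close> with \<open>\<beta>\<close> commuting with \<open>t\<close> and \<open>\<alpha>\<close>, and \<open>\<beta>\<close> has infinite order because some vertex is not
  adjacent to \<open>b\<close>. So every finite-index subgroup contains \<open>x\<close>, \<open>y\<close> whose commutator \<open>z\<close> is central in
  \<open>\<langle>x, y\<rangle>\<close> and of infinite order, and \<open>[x\<^sup>n, y\<^sup>n]\<close> is the \<open>n\<^sup>2\<close>-th power of \<open>z\<close>, which therefore moves a
  point by at most \<open>C n\<close>. If \<open>z\<close> is semi-simple and the action is proper, then the displacement of \<open>z\<close>
  is bounded below by some \<open>L > 0\<close>; in a \<open>CAT(0)\<close> space the lower bound doubles when \<open>z\<close> is squared, so
  that \<open>n\<^sup>2 L \<le> C n\<close> for all powers \<open>n\<close> of 2, a contradiction.\<close>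

section \<open>Displacement in \<open>CAT(0)\<close> spaces\<close>

text \<open>\<open>CAT0_inequality\<close> yields a bound only once a comparison triangle is
  exhibited. The base is placed symmetrically about the origin, and Pythagoras gives the height
  \<open>h\<close> of the apex.\<close>

lemma isosceles_comparison_triangle:
  fixes l s :: real
  assumes "0 \<le> s" "s \<le> 2 * l"
  obtains p q r :: "real^2" where "dist p q = l" "dist q r = l" "dist r p = s"
proof -
  define h where "h = sqrt (l\<^sup>2 - (s/2)\<^sup>2)"
  have "(s/2)\<^sup>2 \<le> l\<^sup>2"
    using assms by (intro power_mono) auto
  then have "h\<^sup>2 = l\<^sup>2 - (s/2)\<^sup>2"
    by (simp add: h_def)
  then have "sqrt ((s/2)\<^sup>2 + h\<^sup>2) = l"
    using assms by simp
  then show thesis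
    using assms
    by (intro that[of "vector [-s/2, 0]" "vector [0, h]" "vector [s/2, 0]"])
      (simp_all add: dist_vec_def L2_set_def sum_2 dist_real_def power_divide)
qed

context CAT0_space
begin

text \<open>\<open>f\<close> maps the midpoint of \<open>y\<close> and \<open>f y\<close> to that of \<open>f y\<close> and \<open>f (f y)\<close>, and by comparison
  these midpoints are at most half as far apart as \<open>y\<close> and \<open>f (f y)\<close>.\<close>

lemma displacement_square_ge:
  assumes f: "f \<in> M \<rightarrow> M" and iso: "\<And>x y. x \<in> M \<Longrightarrow> y \<in> M \<Longrightarrow> d (f x) (f y) = d x y"
    and L: "\<And>x. x \<in> M \<Longrightarrow> L \<le> d x (f x)" and y: "y \<in> M"
  shows "2 * L \<le> d y (f (f y))"
proof -
  let ?q = "f y" and ?r = "f (f y)"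
  have q: "?q \<in> M" and r: "?r \<in> M"
    using f y by auto
  obtain S1 l c where c: "geodesic_path y ?q l c" and S1: "S1 = c ` {0..l}"
    using geodesic[OF y q] unfolding geodesic_segment_def by blast
  from c have l0: "0 \<le> l" and cM: "c ` {0..l} \<subseteq> M" and c0: "c 0 = y" and cl: "c l = ?q"
    and cd: "\<And>s t. s \<in> {0..l} \<Longrightarrow> t \<in> {0..l} \<Longrightarrow> d (c s) (c t) = \<bar>s - t\<bar>"
    unfolding geodesic_path_def by auto
  have dl: "d y ?q = l"
    using cd[of 0 l] l0 c0 cl by simp
  have dl': "d ?q ?r = l"
    using iso y q dl by simp
  define m where "m = c (l/2)"
  have half: "l/2 \<in> {0..l}"
    using l0 by simp
  then have m: "m \<in> M" "m \<in> S1"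
    using cM by (auto simp: m_def S1)
  have ym: "d y m = l/2"
    using cd[of 0 "l/2"] half l0 c0 by (simp add: m_def)
  \<comment> \<open>The side from \<open>f y\<close> to \<open>f (f y)\<close> is chosen as the
    image of the first side, so that \<open>f m\<close> is its midpoint.\<close>
  have "geodesic_path ?q ?r l (f \<circ> c)"
    unfolding geodesic_path_def
    using l0 cM c0 cl f cd iso by (auto simp: image_subset_iff)
  then have S2: "geodesic_segment ?q ?r ((f \<circ> c) ` {0..l})"
    unfolding geodesic_segment_def by blast
  obtain S3 where S3: "geodesic_segment ?r y S3"
    using geodesic[OF r y] by blast
  have "geodesic_segment y ?q S1"
    using c S1 unfolding geodesic_segment_def by blast
  with S2 S3 have ineq: "CAT0_inequality y ?q ?r S1 ((f \<circ> c) ` {0..l}) S3"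
    by (intro CAT0) (simp add: geodesic_triangle_def y q r)
  have "d y ?r \<le> 2 * l"
    using triangle[OF y q r] dl dl' by simp
  then obtain p' q' r' :: "real^2"
    where t: "dist p' q' = l" "dist q' r' = l" "dist r' p' = d y ?r"
    using isosceles_comparison_triangle[of "d y ?r" l] by auto
  then have "comparison_triangle y ?q ?r p' q' r'"
    by (simp add: comparison_triangle_def dl dl' commute)
  moreover have "side_comparison_point y S1 p' q' m (midpoint p' q')"
    using m ym t by (simp add: side_comparison_point_def dist_midpoint)
  moreover have "side_comparison_point ?q ((f \<circ> c) ` {0..l}) q' r' (f m) (midpoint q' r')"
    using half ym iso[OF y m(1)] t
    by (auto simp: side_comparison_point_def dist_midpoint m_def)
  ultimately have "d m (f m) \<le> dist (midpoint p' q') (midpoint q' r')"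
    using ineq unfolding CAT0_inequality_def comparison_point_def by blast
  \<comment> \<open>The segment joining the midpoints of two sides of a Euclidean triangle is half
    as long as the third side.\<close>
  also have "midpoint p' q' - midpoint q' r' = (1/2) *\<^sub>R (p' - r')"
    by (simp add: midpoint_def algebra_simps)
  then have "dist (midpoint p' q') (midpoint q' r') = dist r' p' / 2"
    by (simp add: dist_norm norm_minus_commute)
  \<comment> \<open>The lower bound \<open>L\<close> enters at the midpoint \<open>m\<close>, not at
    \<open>y\<close>.\<close>
  finally show ?thesis
    using L[OF m(1)] t by simp
qed

text \<open>Repeated squaring: the induction hypothesis, at every point of \<open>M\<close>, is a
  displacement bound for \<open>f ^^ (2 ^ k)\<close>, which again preserves distances.\<close>

lemma displacement_funpow_ge:
  assumes f: "f \<in> M \<rightarrow> M" and iso: "\<And>x y. x \<in> M \<Longrightarrow> y \<in> M \<Longrightarrow> d (f x) (f y) = d x y"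
    and L: "\<And>x. x \<in> M \<Longrightarrow> L \<le> d x (f x)" and y: "y \<in> M"
  shows "2 ^ k * L \<le> d y ((f ^^ (2 ^ k)) y)"
  using y
proof (induction k arbitrary: y)
  case 0
  then show ?case using L by simp
next
  case (Suc k)
  let ?g = "f ^^ (2 ^ k)"
  have g: "(f ^^ n) x \<in> M" if "x \<in> M" for n x
    using that f by (induction n) auto
  have giso: "d ((f ^^ n) x) ((f ^^ n) x') = d x x'" if "x \<in> M" "x' \<in> M" for n x x'
    using that by (induction n) (auto simp: iso g)
  have "2 * (2 ^ k * L) \<le> d y (?g (?g y))"
    by (rule displacement_square_ge[OF _ giso Suc.IH Suc.prems]) (simp add: g)
  also have "?g (?g y) = (f ^^ (2 ^ Suc k)) y"
    by (simp only: power_Suc mult_2 funpow_add o_apply)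
  finally show ?case
    by (simp only: power_Suc mult.assoc)
qed

end

section \<open>Powers of a central commutator and their displacement\<close>

text \<open>Moving one \<open>x\<close> past one \<open>y\<close> produces a factor
  \<open>z\<close>, which commutes with both, so moving \<open>m\<close> copies past
  \<open>n\<close> copies produces \<open>m * n\<close> of them. First one \<open>x\<close> is moved
  past a power of \<open>y\<close>, then induction on \<open>m\<close> follows.\<close>

lemma (in group) commutator_pow_mult:
  assumes "x \<in> carrier G" "y \<in> carrier G" "z \<in> carrier G"
    and xy: "x \<otimes> y = z \<otimes> (y \<otimes> x)" and zx: "z \<otimes> x = x \<otimes> z" and zy: "z \<otimes> y = y \<otimes> z"
  shows "x [^] (m::nat) \<otimes> y [^] (n::nat) = z [^] (m * n) \<otimes> (y [^] n \<otimes> x [^] m)"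
proof -
  have one: "x \<otimes> y [^] n = z [^] n \<otimes> (y [^] n \<otimes> x)" for n :: nat
  proof (induction n)
    case (Suc n)
    have "x \<otimes> y [^] Suc n = x \<otimes> y [^] n \<otimes> y"
      using assms by (simp add: m_assoc)
    also have "\<dots> = z [^] n \<otimes> (y [^] n \<otimes> (x \<otimes> y))"
      using assms by (simp add: Suc m_assoc)
    also have "\<dots> = z [^] n \<otimes> ((y [^] n \<otimes> z) \<otimes> (y \<otimes> x))"
      using assms by (simp add: m_assoc)
    also have "y [^] n \<otimes> z = z \<otimes> y [^] n"
      using assms by (metis group_commutes_pow)
    finally show ?case
      using assms by (simp add: m_assoc)
  qed (use assms in auto)
  show ?thesis
  proof (induction m)
    case (Suc m)
    have "x [^] Suc m \<otimes> y [^] n = x [^] m \<otimes> (x \<otimes> y [^] n)"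
      using assms by (simp add: m_assoc)
    also have "\<dots> = (x [^] m \<otimes> z [^] n) \<otimes> (y [^] n \<otimes> x)"
      using assms by (simp add: one m_assoc)
    also have "x [^] m \<otimes> z [^] n = z [^] n \<otimes> x [^] m"
      using assms by (metis group_commutes_pow nat_pow_closed)
    also have "z [^] n \<otimes> x [^] m \<otimes> (y [^] n \<otimes> x) = z [^] n \<otimes> (x [^] m \<otimes> y [^] n) \<otimes> x"
      using assms by (simp add: m_assoc)
    also have "\<dots> = (z [^] n \<otimes> z [^] (m * n)) \<otimes> (y [^] n \<otimes> (x [^] m \<otimes> x))"
      using assms by (simp add: Suc m_assoc)
    finally show ?case
      using assms by (simp add: nat_pow_mult)
  qed (use assms in auto)
qed

text \<open>With \<open>z\<close> of infinite order, the displacement of its \<open>n * n\<close>-th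
  power would be at least quadratic in \<open>n\<close>, for \<open>n\<close> a power of 2, yet at
  most linear, since that power is a commutator of \<open>n\<close>-th powers.\<close>

lemma (in CAT0_space) semi_simple_central_commutator_finite_order:
  assumes "group G" and M: "M \<noteq> {}"
    and act: "isometric_action G \<phi>" and proper: "proper_action G \<phi>"
    and x: "x \<in> carrier G" and y: "y \<in> carrier G" and z: "z \<in> carrier G"
    and xy: "x \<otimes>\<^bsub>G\<^esub> y = z \<otimes>\<^bsub>G\<^esub> (y \<otimes>\<^bsub>G\<^esub> x)"
    and zx: "z \<otimes>\<^bsub>G\<^esub> x = x \<otimes>\<^bsub>G\<^esub> z" and zy: "z \<otimes>\<^bsub>G\<^esub> y = y \<otimes>\<^bsub>G\<^esub> z"
    and ss: "semi_simple (\<phi> z)"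
  shows "\<exists>n>0. z [^]\<^bsub>G\<^esub> (n::nat) = \<one>\<^bsub>G\<^esub>"
proof (rule ccontr)
  assume inf: "\<not> ?thesis"
  interpret group G by fact
  interpret group_action G M \<phi>
    using act by (simp add: isometric_action_def)
  have iso: "d (\<phi> g u) (\<phi> g v) = d u v" if "g \<in> carrier G" "u \<in> M" "v \<in> M" for g u v
    using act that by (auto simp: isometric_action_def)
  have mem: "\<phi> g u \<in> M" if "g \<in> carrier G" "u \<in> M" for g u
    using that element_image by blast
  have pow: "\<phi> (z [^]\<^bsub>G\<^esub> n) u = (\<phi> z ^^ n) u" if "u \<in> M" for n :: nat and u
    using that
  proof (induction n arbitrary: u)
    case 0
    then show ?case by (simp add: id_eq_one[symmetric])
  next
    case (Suc n)
    then show ?case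
      using z by (simp add: composition_rule mem funpow_Suc_right del: funpow.simps)
  qed
  define L where "L = (INF y\<in>M. d y (\<phi> z y))"
  obtain w where w: "w \<in> M" "d w (\<phi> z w) = L"
    using ss by (auto simp: semi_simple_def L_def)
  have L: "L \<le> d u (\<phi> z u)" if "u \<in> M" for u
    unfolding L_def using that by (intro cINF_lower) (auto intro: bdd_belowI[of _ 0])
  have inj: "inj (\<lambda>n::nat. z [^]\<^bsub>G\<^esub> n)"
  proof (rule linorder_injI)
    fix m n :: nat
    assume "m < n"
    show "z [^]\<^bsub>G\<^esub> m \<noteq> z [^]\<^bsub>G\<^esub> n"
    proof
      assume eq: "z [^]\<^bsub>G\<^esub> m = z [^]\<^bsub>G\<^esub> n"
      have "z [^]\<^bsub>G\<^esub> m \<otimes>\<^bsub>G\<^esub> z [^]\<^bsub>G\<^esub> (n - m) = z [^]\<^bsub>G\<^esub> m"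
        using z \<open>m < n\<close> by (simp add: nat_pow_mult eq[symmetric])
      then have "z [^]\<^bsub>G\<^esub> (n - m) = \<one>\<^bsub>G\<^esub>"
        using z by (simp add: l_cancel_one)
      then show False
        using inf \<open>m < n\<close> by (meson zero_less_diff)
    qed
  qed
  \<comment> \<open>An attained infimum of zero makes \<open>w\<close> a fixed point of
    \<open>z\<close>, and then infinitely many distinct powers of \<open>z\<close> contradict
    properness at \<open>w\<close>.\<close>
  have "L \<noteq> 0"
  proof
    assume "L = 0"
    then have fix_w: "\<phi> z w = w"
      using w mem z by simp
    have fix_pow: "\<phi> (z [^]\<^bsub>G\<^esub> n) w = w" for n :: nat
      using w by (simp add: pow) (induction n; simp add: fix_w)
    obtain r where "r > 0" and fin: "finite {g \<in> carrier G. \<phi> g ` mball w r \<inter> mball w r \<noteq> {}}"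
      using proper w unfolding proper_action_def by blast
    have "w \<in> mball w r"
      using w \<open>r > 0\<close> by simp
    then have "range (\<lambda>n::nat. z [^]\<^bsub>G\<^esub> n) \<subseteq> {g \<in> carrier G. \<phi> g ` mball w r \<inter> mball w r \<noteq> {}}"
      using z fix_pow by (force simp del: in_mball)
    then show False
      using fin inj by (meson finite_subset range_inj_infinite)
  qed
  then have "L > 0"
    using w nonneg[of w "\<phi> z w"] by linarith
  define D where "D g = d w (\<phi> g w)" for g
  have D_mult: "D (g \<otimes>\<^bsub>G\<^esub> h) \<le> D g + D h" if "g \<in> carrier G" "h \<in> carrier G" for g h
    using that w triangle[of w "\<phi> g w" "\<phi> g (\<phi> h w)"] by (simp add: D_def composition_rule mem iso)
  \<comment> \<open>The path from \<open>w\<close> to \<open>\<phi> g w\<close> goes through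
    \<open>\<phi> g (\<phi> h w)\<close>. This strips a right factor without passing to its
    inverse.\<close>
  have D_cancel: "D g \<le> D (g \<otimes>\<^bsub>G\<^esub> h) + D h" if "g \<in> carrier G" "h \<in> carrier G" for g h
    using that w triangle[of w "\<phi> g (\<phi> h w)" "\<phi> g w"]
    by (simp add: D_def composition_rule mem iso commute)
  have D_pow: "D (g [^]\<^bsub>G\<^esub> n) \<le> n * D g" if "g \<in> carrier G" for g and n :: nat
  proof (induction n)
    case 0
    show ?case using w by (simp add: D_def id_eq_one[symmetric])
  next
    case (Suc n)
    then show ?case using that D_mult[of "g [^]\<^bsub>G\<^esub> n" g] by (simp add: algebra_simps)
  qed
  have bound: "2 ^ k * L \<le> 2 * (D x + D y)" for k
  proof -
    define n :: nat where "n = 2 ^ k"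
    let ?yx = "y [^]\<^bsub>G\<^esub> n \<otimes>\<^bsub>G\<^esub> x [^]\<^bsub>G\<^esub> n"
    have "n * n = 2 ^ (2 * k)"
      by (simp add: n_def power_add mult_2)
    then have "2 ^ (2 * k) * L \<le> D (z [^]\<^bsub>G\<^esub> (n * n))"
      using displacement_funpow_ge[of "\<phi> z" L w "2 * k"] mem z iso L w by (simp add: D_def pow)
    \<comment> \<open>Here \<open>?yx\<close> is the factor stripped: multiplying the power of
      \<open>z\<close> by it gives the product of the powers in the other order.\<close>
    also have "\<dots> \<le> D (x [^]\<^bsub>G\<^esub> n \<otimes>\<^bsub>G\<^esub> y [^]\<^bsub>G\<^esub> n) + D ?yx"
      using D_cancel[of "z [^]\<^bsub>G\<^esub> (n * n)" ?yx] x y z commutator_pow_mult[OF x y z xy zx zy, of n n] by simp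
    also have "\<dots> \<le> (n * D x + n * D y) + (n * D y + n * D x)"
      using x y by (intro add_mono order_trans[OF D_mult] D_pow nat_pow_closed)
    also have "\<dots> = 2 ^ k * (2 * (D x + D y))"
      by (simp add: n_def algebra_simps)
    also have "(2::real) ^ (2 * k) * L = 2 ^ k * (2 ^ k * L)"
      by (simp add: mult_2 power_add)
    finally have "2 ^ k * (2 ^ k * L) \<le> 2 ^ k * (2 * (D x + D y))" .
    then show ?thesis
      by simp
  qed
  obtain k where "2 * (D x + D y) / L < 2 ^ k"
    using real_arch_pow[of 2] by auto
  with bound[of k] \<open>L > 0\<close> show False
    by (simp add: field_simps)
qed

text \<open>Pigeonhole: two different powers of \<open>x\<close> lie in the same coset, and their
  quotient is a positive power in \<open>H\<close>.\<close>

lemma (in group) ex_pow_mem_finite_index: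
  assumes H: "subgroup H G" and fin: "finite (rcosets H)" and x: "x \<in> carrier G"
  shows "\<exists>n>0. x [^] (n::nat) \<in> H"
proof -
  have "(\<lambda>n::nat. H #> x [^] n) ` UNIV \<subseteq> rcosets H"
    using x subgroup.subset[OF H] by (auto intro: rcosetsI)
  then have "\<not> inj (\<lambda>n::nat. H #> x [^] n)"
    using fin by (meson finite_subset range_inj_infinite)
  then obtain m n :: nat where mn: "m < n" "H #> x [^] m = H #> x [^] n"
    by (metis linorder_injI)
  then have "x [^] n \<in> H #> x [^] m"
    using repr_independenceD[OF H] x by simp
  then have "x [^] n \<otimes> inv (x [^] m) \<in> H"
    using subgroup.rcos_module_imp[OF H is_group] x by simp
  moreover have "x [^] n \<otimes> inv (x [^] m) = x [^] (n - m)"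
    using mn x inv_solve_right[of "x [^] (n - m)" "x [^] n" "x [^] m"] by (simp add: nat_pow_mult)
  ultimately show ?thesis
    using mn by (metis zero_less_diff)
qed


section \<open>Homomorphisms from presented groups\<close>

definition letter_eval :: "('g, 'c) monoid_scheme \<Rightarrow> ('a \<Rightarrow> 'g) \<Rightarrow> 'a \<times> bool \<Rightarrow> 'g" where
  "letter_eval G f x = (if snd x then f (fst x) else inv\<^bsub>G\<^esub> f (fst x))"

primrec word_eval :: "('g, 'c) monoid_scheme \<Rightarrow> ('a \<Rightarrow> 'g) \<Rightarrow> 'a word \<Rightarrow> 'g" where
  "word_eval G f [] = \<one>\<^bsub>G\<^esub>"
| "word_eval G f (x # w) = letter_eval G f x \<otimes>\<^bsub>G\<^esub> word_eval G f w"

context group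
begin

lemma letter_eval_closed: "f \<in> S \<rightarrow> carrier G \<Longrightarrow> fst x \<in> S \<Longrightarrow> letter_eval G f x \<in> carrier G"
  by (auto simp: letter_eval_def)

lemma word_eval_closed: "f \<in> S \<rightarrow> carrier G \<Longrightarrow> w \<in> words S \<Longrightarrow> word_eval G f w \<in> carrier G"
  by (induction w) (auto simp: letter_eval_closed)

lemma word_eval_append:
  assumes "f \<in> S \<rightarrow> carrier G" "u \<in> words S" "v \<in> words S"
  shows "word_eval G f (u @ v) = word_eval G f u \<otimes> word_eval G f v"
  using assms(2)
  by (induction u) (auto simp: assms m_assoc word_eval_closed[of f S] letter_eval_closed[of f S])

text \<open>A rewriting step deletes a cancelling pair or a relator, and both evaluate to the
  identity. Hence evaluation descends to the presented group.\<close>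

lemma word_eval_equivclp:
  assumes f: "f \<in> S \<rightarrow> carrier G" and R: "\<And>r. r \<in> R \<Longrightarrow> r \<in> words S \<Longrightarrow> word_eval G f r = \<one>"
    and uv: "equivclp (word_step S R) u v"
  shows "word_eval G f u = word_eval G f v"
proof -
  have step: "word_eval G f u = word_eval G f v" if "word_step S R u v" for u v
    using that
  proof cases
    case (cancel x y s e)
    have "f s \<in> carrier G"
      using f cancel by auto
    then have "word_eval G f [(s, e), (s, \<not> e)] = \<one>"
      by (cases e) (simp_all add: letter_eval_def)
    then show ?thesis
      using cancel f word_eval_closed[OF f]
      by (simp add: word_eval_append[OF f] del: append_Cons word_eval.simps)
  next
    case (relator x y r)
    then show ?thesis
      using f R word_eval_closed[OF f] by (simp add: word_eval_append[OF f])
  qed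
  show ?thesis
    using uv by (induction rule: equivclp_induct) (auto dest: step)
qed

lemma hom_word_eval:
  assumes "group K" "h \<in> hom G K" and f: "f \<in> S \<rightarrow> carrier G" and "w \<in> words S"
  shows "h (word_eval G f w) = word_eval K (\<lambda>s. h (f s)) w"
proof -
  interpret h: group_hom G K h
    using assms by (simp add: group_hom_def group_hom_axioms_def is_group)
  show ?thesis
    using assms(4)
  proof (induction w)
    case (Cons x w)
    moreover have "h (letter_eval G f x) = letter_eval K (\<lambda>s. h (f s)) x"
      using f Cons.prems by (simp add: letter_eval_def Pi_iff)
    ultimately show ?case
      by (simp add: letter_eval_closed[OF f] word_eval_closed[OF f])
  qed simp
qed

lemma word_eval_commutator_word:
  assumes "f v \<in> carrier G" "f w \<in> carrier G"
  shows "word_eval G f (commutator_word v w) = \<one> \<longleftrightarrow> f v \<otimes> f w = f w \<otimes> f v"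
proof -
  have "word_eval G f (commutator_word v w) = (f v \<otimes> f w) \<otimes> inv (f w \<otimes> f v)"
    using assms by (simp add: commutator_word_def letter_eval_def m_assoc inv_mult_group)
  then show ?thesis
    using assms inv_solve_right'[of \<one> "f v \<otimes> f w" "f w \<otimes> f v"] by auto
qed

end

text \<open>This shows that the classes of the generators generate the group. The point to check is
  that the class of \<open>(s, False)\<close> is the inverse of that of
  \<open>(s, True)\<close>.\<close>

lemma word_eval_presented_group:
  assumes "w \<in> words S"
  shows "word_eval (presented_group S R) (\<lambda>s. word_rel S R `` {[(s, True)]}) w = word_rel S R `` {w}"
proof -
  let ?G = "presented_group S R"
  interpret group ?G
    by (rule group_presented_group)
  have mem: "word_rel S R `` {u} \<in> carrier ?G" if "u \<in> words S" for u
    using that by (simp add: presented_group_def quotientI)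
  have one: "\<one>\<^bsub>?G\<^esub> = word_rel S R `` {[]}"
    by (simp add: presented_group_def)
  have letter: "letter_eval ?G (\<lambda>s. word_rel S R `` {[(s, True)]}) x = word_rel S R `` {[x]}"
    if "fst x \<in> S" for x
  proof (cases x)
    case (Pair s e)
    have "word_step S R ([] @ [(s, False), (s, \<not> False)] @ []) ([] @ [])"
      using that Pair by (intro word_step.cancel) auto
    then have "([(s, False), (s, True)], []) \<in> word_rel S R"
      using that Pair by (auto simp: word_rel_def)
    then have "word_rel S R `` {[(s, False)]} \<otimes>\<^bsub>?G\<^esub> word_rel S R `` {[(s, True)]} = \<one>\<^bsub>?G\<^esub>"
      using that Pair equiv_class_eq[OF equiv_word_rel]
      by (simp add: one mult_presented_group)
    then have "inv\<^bsub>?G\<^esub> (word_rel S R `` {[(s, True)]}) = word_rel S R `` {[(s, False)]}"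
      using that Pair by (intro inv_equality mem) auto
    with Pair show ?thesis
      by (simp add: letter_eval_def)
  qed
  show ?thesis
    using assms
  proof (induction w)
    case (Cons x w)
    then show ?case
      by (simp add: letter mult_presented_group)
  qed (simp add: one)
qed

lemma carrier_presented_groupE:
  assumes "A \<in> carrier (presented_group S R)"
  obtains w where "w \<in> words S" "A = word_rel S R `` {w}"
  using assms by (auto simp: presented_group_def elim: quotientE)

text \<open>Von Dyck's theorem, the universal property of a presentation.\<close>

lemma presented_group_hom_exists:
  assumes "group G" and f: "f \<in> S \<rightarrow> carrier G"
    and R: "\<And>r. r \<in> R \<Longrightarrow> r \<in> words S \<Longrightarrow> word_eval G f r = \<one>\<^bsub>G\<^esub>"
  obtains h where "h \<in> hom (presented_group S R) G" "h \<in> extensional (carrier (presented_group S R))"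
    "\<And>w. w \<in> words S \<Longrightarrow> h (word_rel S R `` {w}) = word_eval G f w"
proof -
  interpret group G by fact
  let ?P = "presented_group S R"
  \<comment> \<open>Evaluation is constant on each class, so its image there is a singleton. The
    restriction makes \<open>h\<close> extensional, as membership in \<open>auto\<close>
    demands.\<close>
  define h where "h = (\<lambda>A\<in>carrier ?P. the_elem (word_eval G f ` A))"
  have mem: "word_rel S R `` {w} \<in> carrier ?P" if "w \<in> words S" for w
    using that by (simp add: presented_group_def quotientI)
  have h: "h (word_rel S R `` {w}) = word_eval G f w" if "w \<in> words S" for w
  proof -
    have "w \<in> word_rel S R `` {w}"
      using that by (simp add: word_rel_def)
    moreover have "word_eval G f u = word_eval G f w" if "u \<in> word_rel S R `` {w}" for u
      using that word_eval_equivclp[OF f R, where u = w and v = u] by (simp add: word_rel_def)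
    ultimately have "word_eval G f ` (word_rel S R `` {w}) = {word_eval G f w}"
      by blast
    then show ?thesis
      using that by (simp add: h_def mem)
  qed
  have "h \<in> hom ?P G"
  proof (rule homI)
    fix A B assume "A \<in> carrier ?P" "B \<in> carrier ?P"
    then show "h (A \<otimes>\<^bsub>?P\<^esub> B) = h A \<otimes>\<^bsub>G\<^esub> h B"
      by (elim carrier_presented_groupE) (simp add: mult_presented_group h word_eval_append[OF f])
  next
    fix A assume "A \<in> carrier ?P"
    then show "h A \<in> carrier G"
      by (elim carrier_presented_groupE) (simp add: h word_eval_closed[OF f])
  qed
  then show thesis
    using h by (intro that[of h]) (auto simp: h_def)
qed

section \<open>Homomorphisms and automorphisms of right-angled Artin groups\<close>

definition raag_gen :: "'v set \<Rightarrow> 'v set set \<Rightarrow> 'v \<Rightarrow> 'v word set" where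
  "raag_gen V E v =
    word_rel V {commutator_word v w | v w. v \<in> V \<and> w \<in> V \<and> {v, w} \<in> E} `` {[(v, True)]}"

lemma raag_gen_closed [simp]: "v \<in> V \<Longrightarrow> raag_gen V E v \<in> carrier (raag V E)"
  by (simp add: raag_gen_def raag_def presented_group_def quotientI)

lemma raag_hom_exists:
  assumes "group G" and f: "f \<in> V \<rightarrow> carrier G"
    and comm: "\<And>v w. v \<in> V \<Longrightarrow> w \<in> V \<Longrightarrow> {v, w} \<in> E \<Longrightarrow> f v \<otimes>\<^bsub>G\<^esub> f w = f w \<otimes>\<^bsub>G\<^esub> f v"
  obtains h where "h \<in> hom (raag V E) G" "h \<in> extensional (carrier (raag V E))"
    "\<And>v. v \<in> V \<Longrightarrow> h (raag_gen V E v) = f v"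
proof -
  interpret group G by fact
  let ?R = "{commutator_word v w | v w. v \<in> V \<and> w \<in> V \<and> {v, w} \<in> E}"
  have "word_eval G f r = \<one>\<^bsub>G\<^esub>" if "r \<in> ?R" for r
    using that comm f by (auto simp: word_eval_commutator_word Pi_iff)
  then obtain h where h: "h \<in> hom (presented_group V ?R) G"
      "h \<in> extensional (carrier (presented_group V ?R))"
      "\<And>w. w \<in> words V \<Longrightarrow> h (word_rel V ?R `` {w}) = word_eval G f w"
    using presented_group_hom_exists[OF assms(1) f, of ?R] by blast
  show thesis
  proof (rule that[of h])
    show "h (raag_gen V E v) = f v" if "v \<in> V" for v
      using that f h(3)[of "[(v, True)]"] by (simp add: raag_gen_def letter_eval_def Pi_iff)
  qed (use h in \<open>simp_all add: raag_def\<close>)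
qed

lemma carrier_raagE:
  assumes "A \<in> carrier (raag V E)"
  obtains w where "w \<in> words V" "A = word_eval (raag V E) (raag_gen V E) w"
proof -
  let ?R = "{commutator_word v w | v w. v \<in> V \<and> w \<in> V \<and> {v, w} \<in> E}"
  from assms obtain w where w: "w \<in> words V" "A = word_rel V ?R `` {w}"
    unfolding raag_def by (rule carrier_presented_groupE)
  have "word_eval (raag V E) (raag_gen V E) w = word_rel V ?R `` {w}"
    using word_eval_presented_group[OF w(1), of ?R] by (simp add: raag_def raag_gen_def[abs_def])
  then show thesis
    using w by (intro that[of w]) (auto simp only:)
qed

text \<open>Both maps are determined by the images of the generators, since every element is the
  value of a word in them. This serves to recognize mutually inverse endomorphisms.\<close>

lemma raag_hom_eqI:
  assumes "group K" "h \<in> hom (raag V E) K" "k \<in> hom (raag V E) K"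
    and eq: "\<And>v. v \<in> V \<Longrightarrow> h (raag_gen V E v) = k (raag_gen V E v)"
    and A: "A \<in> carrier (raag V E)"
  shows "h A = k A"
proof -
  interpret group "raag V E"
    by (rule group_raag)
  obtain w where w: "w \<in> words V" "A = word_eval (raag V E) (raag_gen V E) w"
    using A by (rule carrier_raagE)
  have gen: "raag_gen V E \<in> V \<rightarrow> carrier (raag V E)"
    by simp
  have "word_eval K (\<lambda>v. h (raag_gen V E v)) w = word_eval K (\<lambda>v. k (raag_gen V E v)) w"
    using w(1) by (induction w) (auto simp: letter_eval_def eq)
  then show ?thesis
    using hom_word_eval[OF assms(1) assms(2) gen w(1)] hom_word_eval[OF assms(1) assms(3) gen w(1)]
    by (simp add: w(2))
qed

lemma raag_gen_commute:
  assumes "v \<in> V" "w \<in> V" "{v, w} \<in> E"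
  shows "raag_gen V E v \<otimes>\<^bsub>raag V E\<^esub> raag_gen V E w = raag_gen V E w \<otimes>\<^bsub>raag V E\<^esub> raag_gen V E v"
proof -
  let ?R = "{commutator_word v w | v w. v \<in> V \<and> w \<in> V \<and> {v, w} \<in> E}" and ?c = "commutator_word v w"
  interpret group "raag V E"
    by (rule group_raag)
  have c: "?c \<in> words V"
    using assms by (simp add: commutator_word_def)
  then have "word_step V ?R ([] @ ?c @ []) ([] @ [])"
    using assms by (intro word_step.relator) auto
  then have "(?c, []) \<in> word_rel V ?R"
    using c by (auto simp: word_rel_def)
  then have "word_rel V ?R `` {?c} = word_rel V ?R `` {[]}"
    by (rule equiv_class_eq[OF equiv_word_rel])
  moreover have "word_eval (raag V E) (raag_gen V E) ?c = word_rel V ?R `` {?c}"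
    using word_eval_presented_group[OF c, of ?R] by (simp add: raag_def raag_gen_def[abs_def])
  moreover have "\<one>\<^bsub>raag V E\<^esub> = word_rel V ?R `` {[]}"
    by (simp add: raag_def presented_group_def)
  ultimately show ?thesis
    using assms word_eval_commutator_word[of "raag_gen V E" v w] by simp
qed

text \<open>By \<open>a \<le> b\<close>, every generator adjacent to \<open>a\<close> commutes with
  \<open>b\<close> as well as with \<open>a\<close>, hence with their product. So replacing
  \<open>a\<close> by \<open>a b\<close> and fixing the other generators respects the
  relators.\<close>

lemma raag_transvection_exists:
  assumes V: "a \<in> V" "b \<in> V" and ab: "b \<in> link V E a" "a \<noteq> b" and le: "vertex_le V E a b"
  obtains t where "t \<in> auto (raag V E)"
    "t (raag_gen V E a) = raag_gen V E a \<otimes>\<^bsub>raag V E\<^esub> raag_gen V E b"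
    "t (raag_gen V E b) = raag_gen V E b"
proof -
  let ?G = "raag V E" and ?\<gamma> = "raag_gen V E"
  interpret group ?G
    by (rule group_raag)
  have comm: "?\<gamma> v \<otimes>\<^bsub>?G\<^esub> ?\<gamma> w = ?\<gamma> w \<otimes>\<^bsub>?G\<^esub> ?\<gamma> v" if "v \<in> V" "w \<in> V" "{v, w} \<in> E" for v w
    using raag_gen_commute[OF that] .
  have comm_b: "?\<gamma> w \<otimes>\<^bsub>?G\<^esub> ?\<gamma> b = ?\<gamma> b \<otimes>\<^bsub>?G\<^esub> ?\<gamma> w" if "w \<in> V" "{a, w} \<in> E" for w
    using that le comm[of b w] V by (auto simp: vertex_le_def link_def star_def)
  \<comment> \<open>Both signs are treated at once: \<open>b\<close> gives the transvection
    \<open>t\<close>, and the inverse of \<open>b\<close> gives its inverse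
    \<open>u\<close>.\<close>
  have ex: "\<exists>t. t \<in> hom ?G ?G \<and> t \<in> extensional (carrier ?G) \<and> t (?\<gamma> a) = ?\<gamma> a \<otimes>\<^bsub>?G\<^esub> \<beta>
      \<and> (\<forall>v\<in>V - {a}. t (?\<gamma> v) = ?\<gamma> v)" if "\<beta> = ?\<gamma> b \<or> \<beta> = inv\<^bsub>?G\<^esub> ?\<gamma> b" for \<beta>
  proof -
    have \<beta>: "\<beta> \<in> carrier ?G"
      using that V by auto
    have comm_\<beta>: "?\<gamma> w \<otimes>\<^bsub>?G\<^esub> \<beta> = \<beta> \<otimes>\<^bsub>?G\<^esub> ?\<gamma> w" if "w \<in> V" "{a, w} \<in> E" for w
    proof -
      have "inv\<^bsub>?G\<^esub> ?\<gamma> b \<otimes>\<^bsub>?G\<^esub> ?\<gamma> w = ?\<gamma> w \<otimes>\<^bsub>?G\<^esub> inv\<^bsub>?G\<^esub> ?\<gamma> b"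
        using comm_b[OF that] that V
        by (metis inv_closed inv_solve_left inv_solve_right m_assoc m_closed raag_gen_closed)
      then show ?thesis
        using comm_b[OF that] \<open>\<beta> = ?\<gamma> b \<or> \<beta> = inv\<^bsub>?G\<^esub> ?\<gamma> b\<close> by auto
    qed
    define f where "f v = (if v = a then ?\<gamma> a \<otimes>\<^bsub>?G\<^esub> \<beta> else ?\<gamma> v)" for v
    have fV: "f \<in> V \<rightarrow> carrier ?G"
      using V \<beta> by (auto simp: f_def)
    have fa: "f a \<otimes>\<^bsub>?G\<^esub> ?\<gamma> w = ?\<gamma> w \<otimes>\<^bsub>?G\<^esub> f a" if "w \<in> V" "{a, w} \<in> E" for w
    proof -
      have "f a \<otimes>\<^bsub>?G\<^esub> ?\<gamma> w = ?\<gamma> a \<otimes>\<^bsub>?G\<^esub> ?\<gamma> w \<otimes>\<^bsub>?G\<^esub> \<beta>"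
        using that V \<beta> by (simp add: f_def m_assoc comm_\<beta>)
      then show ?thesis
        using that V \<beta> comm[of a w] by (simp add: f_def m_assoc)
    qed
    have "f v \<otimes>\<^bsub>?G\<^esub> f w = f w \<otimes>\<^bsub>?G\<^esub> f v" if "v \<in> V" "w \<in> V" "{v, w} \<in> E" for v w
      using that comm[of v w] fa[of v] fa[of w] by (auto simp: f_def insert_commute)
    then obtain h where "h \<in> hom ?G ?G" "h \<in> extensional (carrier ?G)"
        "\<And>v. v \<in> V \<Longrightarrow> h (?\<gamma> v) = f v"
      using raag_hom_exists[OF is_group fV] by metis
    then show ?thesis
      using V by (intro exI[of _ h]) (auto simp: f_def)
  qed
  from ex[of "?\<gamma> b"] obtain t where t: "t \<in> hom ?G ?G" "t \<in> extensional (carrier ?G)"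
      "t (?\<gamma> a) = ?\<gamma> a \<otimes>\<^bsub>?G\<^esub> ?\<gamma> b" "\<And>v. v \<in> V \<Longrightarrow> v \<noteq> a \<Longrightarrow> t (?\<gamma> v) = ?\<gamma> v"
    by auto
  from ex[of "inv\<^bsub>?G\<^esub> ?\<gamma> b"] obtain u where u: "u \<in> hom ?G ?G"
      "u (?\<gamma> a) = ?\<gamma> a \<otimes>\<^bsub>?G\<^esub> inv\<^bsub>?G\<^esub> ?\<gamma> b" "\<And>v. v \<in> V \<Longrightarrow> v \<noteq> a \<Longrightarrow> u (?\<gamma> v) = ?\<gamma> v"
    by auto
  interpret t: group_hom ?G ?G t
    using t by unfold_locales
  interpret u: group_hom ?G ?G u
    using u by unfold_locales
  have b: "t (?\<gamma> b) = ?\<gamma> b" "u (?\<gamma> b) = ?\<gamma> b"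
    using V ab t(4) u(3) by blast+
  have "u (t (?\<gamma> a)) = ?\<gamma> a" "t (u (?\<gamma> a)) = ?\<gamma> a"
    using V by (simp_all add: t(3) u(2) b m_assoc)
  then have "u (t (?\<gamma> v)) = ?\<gamma> v" "t (u (?\<gamma> v)) = ?\<gamma> v" if "v \<in> V" for v
    using that t(4) u(3) by (metis, metis)
  moreover have "u \<circ> t \<in> hom ?G ?G" "t \<circ> u \<in> hom ?G ?G" "id \<in> hom ?G ?G"
    using t(1) u(1) by (auto intro: hom_compose simp: hom_def)
  ultimately have "(u \<circ> t) A = id A" "(t \<circ> u) A = id A" if "A \<in> carrier ?G" for A
    using raag_hom_eqI[OF is_group _ _ _ that, where k = id and h = "u \<circ> t"]
      raag_hom_eqI[OF is_group _ _ _ that, where k = id and h = "t \<circ> u"] by simp_all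
  then have "bij_betw t (carrier ?G) (carrier ?G)"
    by (intro bij_betw_byWitness[of _ u]) auto
  then show thesis
    using t V ab by (intro that[of t]) (auto simp: auto_def Bij_def)
qed

text \<open>Let \<open>b\<close> and \<open>c\<close> act on the integers by \<open>x \<mapsto> x + 1\<close> and \<open>x \<mapsto> - x\<close>, and all other
  generators trivially.\<close>

lemma raag_gen_pow_not_commute:
  assumes "b \<in> V" "c \<in> V" "b \<noteq> c" "{b, c} \<notin> E" "n > 0"
    and E: "\<And>v. {v} \<notin> E"
  shows "raag_gen V E b [^]\<^bsub>raag V E\<^esub> (n::nat) \<otimes>\<^bsub>raag V E\<^esub> raag_gen V E c
    \<noteq> raag_gen V E c \<otimes>\<^bsub>raag V E\<^esub> raag_gen V E b [^]\<^bsub>raag V E\<^esub> n"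
proof
  let ?G = "raag V E" and ?\<gamma> = "raag_gen V E" and ?B = "BijGroup (UNIV :: int set)"
  interpret group ?G
    by (rule group_raag)
  interpret B: group ?B
    by (rule group_BijGroup)
  define f :: "'a \<Rightarrow> int \<Rightarrow> int"
    where "f v = (if v = b then (\<lambda>x. x + 1) else if v = c then uminus else id)" for v
  have car: "g \<in> carrier ?B \<longleftrightarrow> bij g" for g
    by (simp add: BijGroup_def Bij_def)
  have mult: "g \<otimes>\<^bsub>?B\<^esub> h = g \<circ> h" if "bij g" "bij h" for g h
    using that by (auto simp: BijGroup_def Bij_def compose_def)
  have bij_plus: "bij (\<lambda>x. x + k)" for k :: int
    by (intro o_bij[of "\<lambda>x. x - k"]) auto
  have bij_f: "bij (f v)" for v
    unfolding f_def by (auto simp: bij_uminus bij_plus)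
  \<comment> \<open>Only the images of \<open>b\<close> and \<open>c\<close> fail to commute, and
    these two vertices are not adjacent.\<close>
  have "f v \<otimes>\<^bsub>?B\<^esub> f w = f w \<otimes>\<^bsub>?B\<^esub> f v" if "{v, w} \<in> E" for v w
    using that assms by (auto simp: mult bij_f insert_commute) (auto simp: f_def insert_commute)
  then obtain h where "h \<in> hom ?G ?B" and h: "\<And>v. v \<in> V \<Longrightarrow> h (?\<gamma> v) = f v"
    using raag_hom_exists[of ?B f V E] bij_f car B.is_group by (metis Pi_I)
  then interpret h: group_hom ?G ?B h
    by unfold_locales
  have pow: "f b [^]\<^bsub>?B\<^esub> k = (\<lambda>x. x + int k)" for k :: nat
  proof (induction k)
    case 0
    then show ?case by (simp add: BijGroup_def fun_eq_iff)
  next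
    case (Suc k)
    then show ?case
      by (simp add: mult bij_f bij_plus) (auto simp: f_def)
  qed
  assume "?\<gamma> b [^]\<^bsub>?G\<^esub> n \<otimes>\<^bsub>?G\<^esub> ?\<gamma> c = ?\<gamma> c \<otimes>\<^bsub>?G\<^esub> ?\<gamma> b [^]\<^bsub>?G\<^esub> n"
  then have "h (?\<gamma> b [^]\<^bsub>?G\<^esub> n \<otimes>\<^bsub>?G\<^esub> ?\<gamma> c) = h (?\<gamma> c \<otimes>\<^bsub>?G\<^esub> ?\<gamma> b [^]\<^bsub>?G\<^esub> n)"
    by simp
  then have "(\<lambda>x. x + int n) \<circ> f c = f c \<circ> (\<lambda>x. x + int n)"
    using assms by (simp add: h.hom_nat_pow h pow mult bij_f bij_plus)
  \<comment> \<open>At 0 the two sides are \<open>n\<close> and \<open>- n\<close>, which differ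
    because \<open>n > 0\<close>.\<close>
  from fun_cong[OF this, of 0] show False
    using assms by (simp add: f_def)
qed

section \<open>Inner automorphisms and the Heisenberg relation\<close>

context group
begin

definition inner_aut :: "'a \<Rightarrow> 'a \<Rightarrow> 'a" where
  "inner_aut g = (\<lambda>h\<in>carrier G. g \<otimes> h \<otimes> inv g)"

text \<open>That conjugation is an action by bijections is known; what remains is that each
  conjugation is an endomorphism.\<close>

lemma inner_aut_hom: "inner_aut \<in> hom G (AutoGroup G)"
proof -
  have hom: "inner_aut \<in> hom G (BijGroup (carrier G))"
    using conjugation_is_hom by (simp add: inner_aut_def[abs_def])
  have "inner_aut g \<in> auto G" if "g \<in> carrier G" for g
  proof -
    have "inner_aut g \<in> hom G G"
      using that by (intro homI) (simp_all add: inner_aut_def m_assoc, simp add: m_assoc[symmetric])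
    then show ?thesis
      using that hom by (auto simp: auto_def hom_def BijGroup_def)
  qed
  then show ?thesis
    using hom by (auto simp: hom_def AutoGroup_def)
qed

lemma auto_mult_inner_aut:
  assumes t: "t \<in> auto G" and g: "g \<in> carrier G"
  shows "t \<otimes>\<^bsub>AutoGroup G\<^esub> inner_aut g = inner_aut (t g) \<otimes>\<^bsub>AutoGroup G\<^esub> t"
proof -
  interpret t: group_hom G G t
    using t by unfold_locales (simp add: auto_def)
  have inner: "inner_aut g \<in> Bij (carrier G)" if "g \<in> carrier G" for g
    using that inner_aut_hom by (auto simp: hom_def AutoGroup_def auto_def)
  have "t \<otimes>\<^bsub>AutoGroup G\<^esub> inner_aut g = compose (carrier G) t (inner_aut g)"
    using t g inner by (simp add: AutoGroup_def BijGroup_def auto_def)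
  also have "\<dots> = compose (carrier G) (inner_aut (t g)) t"
    using g by (intro ext) (simp add: compose_def inner_aut_def)
  also have "\<dots> = inner_aut (t g) \<otimes>\<^bsub>AutoGroup G\<^esub> t"
    using t g inner by (simp add: AutoGroup_def BijGroup_def auto_def)
  finally show ?thesis .
qed

lemma inner_aut_eq_one_imp_central:
  assumes "inner_aut g = \<one>\<^bsub>AutoGroup G\<^esub>" "g \<in> carrier G" "h \<in> carrier G"
  shows "g \<otimes> h = h \<otimes> g"
proof -
  have "g \<otimes> h \<otimes> inv g = h"
    using fun_cong[OF assms(1), of h] assms(3) by (simp add: inner_aut_def AutoGroup_def BijGroup_def)
  then show ?thesis
    using assms by (metis inv_solve_right' m_closed)
qed

end

section \<open>Heisenberg relations inside a finite-index subgroup\<close>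

text \<open>Suitable powers of \<open>t\<close> and of the inner automorphism of \<open>a\<close>
  lie in \<open>H\<close>, and their commutator is a power of the inner automorphism of
  \<open>b\<close>. Finite order of the latter would make a positive power of \<open>b\<close>
  central, against \<open>inf\<close>.\<close>

lemma (in CAT0_space) transvection_no_proper_semi_simple_action:
  assumes "group G" and t: "t \<in> auto G" and a: "a \<in> carrier G" and b: "b \<in> carrier G"
    and ta: "t a = a \<otimes>\<^bsub>G\<^esub> b" and tb: "t b = b" and ab: "a \<otimes>\<^bsub>G\<^esub> b = b \<otimes>\<^bsub>G\<^esub> a"
    and inf: "\<And>n::nat. n > 0 \<Longrightarrow> \<exists>c\<in>carrier G. b [^]\<^bsub>G\<^esub> n \<otimes>\<^bsub>G\<^esub> c \<noteq> c \<otimes>\<^bsub>G\<^esub> b [^]\<^bsub>G\<^esub> n"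
    and H: "subgroup H (AutoGroup G)" and fin: "finite (rcosets\<^bsub>AutoGroup G\<^esub> H)"
    and M: "M \<noteq> {}"
    and act: "isometric_action ((AutoGroup G)\<lparr>carrier := H\<rparr>) \<phi>"
    and proper: "proper_action ((AutoGroup G)\<lparr>carrier := H\<rparr>) \<phi>"
    and ss: "\<And>h. h \<in> H \<Longrightarrow> semi_simple (\<phi> h)"
  shows False
proof -
  interpret G: group G by fact
  let ?A = "AutoGroup G"
  interpret A: group ?A
    by (rule G.AutoGroup)
  interpret inner: group_hom G ?A G.inner_aut
    using G.inner_aut_hom by unfold_locales
  let ?\<alpha> = "G.inner_aut a" and ?\<beta> = "G.inner_aut b"
  have tA: "t \<in> carrier ?A"
    using t by (simp add: AutoGroup_def)
  have \<alpha>: "?\<alpha> \<in> carrier ?A" and \<beta>: "?\<beta> \<in> carrier ?A"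
    using a b by auto
  have \<beta>\<alpha>: "?\<beta> \<otimes>\<^bsub>?A\<^esub> ?\<alpha> = ?\<alpha> \<otimes>\<^bsub>?A\<^esub> ?\<beta>"
    using a b ab by (simp flip: inner.hom_mult)
  have \<beta>t: "?\<beta> \<otimes>\<^bsub>?A\<^esub> t = t \<otimes>\<^bsub>?A\<^esub> ?\<beta>"
    using G.auto_mult_inner_aut[OF t b] tb by simp
  have t\<alpha>: "t \<otimes>\<^bsub>?A\<^esub> ?\<alpha> = ?\<beta> \<otimes>\<^bsub>?A\<^esub> (?\<alpha> \<otimes>\<^bsub>?A\<^esub> t)"
    using G.auto_mult_inner_aut[OF t a] ta ab a b tA by (simp add: A.m_assoc)
  obtain m n :: nat where m: "m > 0" "t [^]\<^bsub>?A\<^esub> m \<in> H" and n: "n > 0" "?\<alpha> [^]\<^bsub>?A\<^esub> n \<in> H"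
    using A.ex_pow_mem_finite_index[OF H fin] tA \<alpha> by metis
  let ?x = "t [^]\<^bsub>?A\<^esub> m" and ?y = "?\<alpha> [^]\<^bsub>?A\<^esub> n" and ?z = "?\<beta> [^]\<^bsub>?A\<^esub> (m * n)"
  have xy: "?x \<otimes>\<^bsub>?A\<^esub> ?y = ?z \<otimes>\<^bsub>?A\<^esub> (?y \<otimes>\<^bsub>?A\<^esub> ?x)"
    using A.commutator_pow_mult[OF tA \<alpha> \<beta> t\<alpha> \<beta>t \<beta>\<alpha>] .
  have zx: "?z \<otimes>\<^bsub>?A\<^esub> ?x = ?x \<otimes>\<^bsub>?A\<^esub> ?z" and zy: "?z \<otimes>\<^bsub>?A\<^esub> ?y = ?y \<otimes>\<^bsub>?A\<^esub> ?z"
    using tA \<alpha> \<beta> \<beta>t \<beta>\<alpha> by (metis A.group_commutes_pow A.nat_pow_closed)+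
  \<comment> \<open>Written as a commutator of elements of \<open>H\<close>, \<open>?z\<close> lies
    in \<open>H\<close> although its base \<open>?\<beta>\<close> need not.\<close>
  have "?z = (?x \<otimes>\<^bsub>?A\<^esub> ?y) \<otimes>\<^bsub>?A\<^esub> inv\<^bsub>?A\<^esub> (?y \<otimes>\<^bsub>?A\<^esub> ?x)"
    using xy tA \<alpha> \<beta> by (metis A.inv_solve_right A.m_closed A.nat_pow_closed)
  then have z: "?z \<in> H"
    using m n H by (simp add: subgroup.m_closed subgroup.m_inv_closed)
  obtain k :: nat where k: "k > 0" "?z [^]\<^bsub>?A\<^esub> k = \<one>\<^bsub>?A\<^esub>"
    using semi_simple_central_commutator_finite_order[OF A.subgroup_imp_group[OF H] M act proper,
        of ?x ?y ?z] m n z xy zx zy ss[OF z]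
    by (auto simp flip: A.nat_pow_consistent)
  then have "G.inner_aut (b [^]\<^bsub>G\<^esub> (m * n * k)) = \<one>\<^bsub>?A\<^esub>"
    using b \<beta> by (simp add: inner.hom_nat_pow A.nat_pow_pow)
  then have "\<forall>c\<in>carrier G. b [^]\<^bsub>G\<^esub> (m * n * k) \<otimes>\<^bsub>G\<^esub> c = c \<otimes>\<^bsub>G\<^esub> b [^]\<^bsub>G\<^esub> (m * n * k)"
    using b G.inner_aut_eq_one_imp_central by simp
  then show False
    using inf[of "m * n * k"] m n k by auto
qed

theorem corollary1p2:
  fixes V :: "'v set" and E :: "'v set set" and a b :: 'v
  assumes "simplicial_graph V E"
    and "a \<in> V" and "b \<in> V"
    and "b \<in> link V E a"
    and "vertex_le V E a b"
    and "\<not> (\<forall>c \<in> V - {b}. c \<in> link V E b)"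
  shows "\<not> (\<exists>H (M :: 'x set) (d :: 'x \<Rightarrow> 'x \<Rightarrow> real) \<phi>.
            subgroup H (AutoGroup (raag V E)) \<and>
            finite (rcosets\<^bsub>AutoGroup (raag V E)\<^esub> H) \<and>
            CAT0_space M d \<and> M \<noteq> {} \<and>
            Metric_space.isometric_action M d ((AutoGroup (raag V E))\<lparr>carrier := H\<rparr>) \<phi> \<and>
            Metric_space.proper_action M d ((AutoGroup (raag V E))\<lparr>carrier := H\<rparr>) \<phi> \<and>
            (\<forall>h\<in>H. Metric_space.semi_simple M d (\<phi> h)))"
proof -
  have E: "{v} \<notin> E" for v
    using assms(1) by (auto simp: simplicial_graph_def)
  have ab: "{a, b} \<in> E" "a \<noteq> b"
    using assms(4) E[of a] by (auto simp: link_def)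
  obtain t where t: "t \<in> auto (raag V E)"
      "t (raag_gen V E a) = raag_gen V E a \<otimes>\<^bsub>raag V E\<^esub> raag_gen V E b"
      "t (raag_gen V E b) = raag_gen V E b"
    using raag_transvection_exists[OF assms(2-4) ab(2) assms(5)] .
  obtain c where c: "c \<in> V" "b \<noteq> c" "{b, c} \<notin> E"
    using assms(6) by (auto simp: link_def)
  \<comment> \<open>The vertex \<open>c\<close> not adjacent to \<open>b\<close> is a witness for
    all \<open>n\<close> at once.\<close>
  have inf: "\<exists>c\<in>carrier (raag V E). raag_gen V E b [^]\<^bsub>raag V E\<^esub> n \<otimes>\<^bsub>raag V E\<^esub> c
      \<noteq> c \<otimes>\<^bsub>raag V E\<^esub> raag_gen V E b [^]\<^bsub>raag V E\<^esub> n" if "n > 0" for n :: nat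
    using raag_gen_pow_not_commute[OF assms(3) c that E] c(1) by (intro bexI) auto
  show ?thesis
    using CAT0_space.transvection_no_proper_semi_simple_action[OF _ group_raag t(1) _ _ t(2,3)
        raag_gen_commute[OF assms(2,3) ab(1)] inf] assms(2,3)
    by (metis raag_gen_closed)
qed

end
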